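(* Let $\alpha$ be a closed, regular, smooth plane curve of length $l$, parametrized by arc length $s\in\mathbb{S}^1=\mathbb{R}/l\mathbb{Z}$, with curvature $k(s)>0$ for all $s$, and let $\beta(s)=\alpha(s)+\frac{1}{k(s)}n(s)$ be its evolute. Let $p$ be a point in the plane that is not on $\alpha$ or $\beta$, and let $m_p$ be the number of normal segments with $\rho<0$ through $p$. Then $$w^\alpha_p=r^\alpha-m_p.$$
   Context: The unit tangent is $t=\dot\alpha$ and $n$ is the unit normal such that $(t,n)$ is right-handed; the curvature $k$ is defined by $\dot t=k n$ (equivalently $\dot n=-kt$). The curve may have self-intersections. The normal segment to $\alpha$ at $\alpha(s)$ is the set of points $\alpha(s)+\rho\,n(s)$ with $-\infty<\rho<1/k(s)$; here only the portions with $\rho<0$ are counted, so $m_p$ is the number of parameters $s\in\mathbb{S}^1$ for which there is $\rho<0$ with $\alpha(s)+\rho\,n(s)=p$. The rotation index $r^\alpha$ is the degree of the map $\dot\alpha/|\dot\alpha|:\mathbb{S}^1\to\mathbb{S}^1$. The winding index $w^\alpha_p$ of $\alpha$ about $p$ is the degree of the map $(\alpha-p)/|\alpha-p|:\mathbb{S}^1\to\mathbb{S}^1$. *)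

theory Defs
  imports "HOL-Analysis.Analysis"
begin

text \<open>
  The plane is \<^typ>\<open>complex\<close>, and a map on the circle of length \<open>l\<close> (the reals modulo \<open>l\<close>)
  is an \<open>l\<close>-periodic map on \<^typ>\<open>real\<close>.
\<close>

definition smooth_curve :: "(real \<Rightarrow> complex) \<Rightarrow> bool" where
  "smooth_curve \<alpha> \<longleftrightarrow>
     (\<forall>j s. ((\<lambda>\<gamma> u. vector_derivative \<gamma> (at u)) ^^ j) \<alpha> differentiable (at s))"

definition curve_tangent :: "(real \<Rightarrow> complex) \<Rightarrow> real \<Rightarrow> complex" where
  "curve_tangent \<alpha> s = vector_derivative \<alpha> (at s)"

text \<open>Multiplication by \<open>\<i>\<close> is the rotation by a right angle that makes \<open>(t, n)\<close> right-handed.\<close>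

definition curve_normal :: "(real \<Rightarrow> complex) \<Rightarrow> real \<Rightarrow> complex" where
  "curve_normal \<alpha> s = \<i> * curve_tangent \<alpha> s"

definition is_curvature :: "(real \<Rightarrow> complex) \<Rightarrow> (real \<Rightarrow> real) \<Rightarrow> bool" where
  "is_curvature \<alpha> k \<longleftrightarrow>
     (\<forall>s. (curve_tangent \<alpha> has_vector_derivative k s *\<^sub>R curve_normal \<alpha> s) (at s))"

definition evolute :: "(real \<Rightarrow> complex) \<Rightarrow> (real \<Rightarrow> real) \<Rightarrow> real \<Rightarrow> complex" where
  "evolute \<alpha> k s = \<alpha> s + (1 / k s) *\<^sub>R curve_normal \<alpha> s"

text \<open>
  Degree of a continuous \<open>l\<close>-periodic map \<open>f\<close> into the unit circle, by lifting to the universal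
  cover; \<open>circle_degree_eqI\<close> gives uniqueness and \<open>circle_degree_lift\<close> existence.
\<close>

definition circle_degree :: "real \<Rightarrow> (real \<Rightarrow> complex) \<Rightarrow> int" where
  "circle_degree l f =
     (THE d. \<exists>\<theta>. continuous_on UNIV \<theta> \<and> (\<forall>s. f s = cis (\<theta> s)) \<and>
                 (\<forall>s. \<theta> (s + l) = \<theta> s + 2 * pi * of_int d))"

lemma cis_eq_imp_const_diff:
  fixes \<theta> \<phi> :: "real \<Rightarrow> real"
  assumes "continuous_on UNIV \<theta>" "continuous_on UNIV \<phi>" "\<And>s. cis (\<theta> s) = cis (\<phi> s)"
  obtains n :: int where "\<And>s. \<theta> s = \<phi> s + 2 * pi * of_int n"
proof -
  let ?g = "\<lambda>s. (\<theta> s - \<phi> s) / (2 * pi)"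
  have int: "?g s \<in> \<int>" for s
  proof -
    have "cis (\<theta> s - \<phi> s) = 1"
      using assms(3)[of s] by (simp flip: cis_divide)
    then obtain n :: int where "\<theta> s - \<phi> s = 2 * pi * of_int n"
      by (auto simp: complex_eq_iff cos_one_2pi_int)
    then show ?thesis by simp
  qed
  have cont: "continuous_on UNIV ?g"
    by (intro continuous_intros assms) auto
  have "?g constant_on UNIV"
  proof (rule continuous_discrete_range_constant)
    show "\<exists>e>0. \<forall>y. y \<in> UNIV \<and> ?g y \<noteq> ?g x \<longrightarrow> e \<le> norm (?g y - ?g x)" for x
    proof (intro exI[of _ 1] conjI allI impI)
      fix y assume "y \<in> UNIV \<and> ?g y \<noteq> ?g x"
      then show "1 \<le> norm (?g y - ?g x)"
        using Ints_nonzero_abs_ge1[OF Ints_diff[OF int[of y] int[of x]]] by simp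
    qed simp
  qed (use cont in auto)
  then obtain c where c: "\<And>s. ?g s = c"
    by (auto simp: constant_on_def)
  then obtain n where "c = of_int n"
    using int[of 0] by (auto elim: Ints_cases)
  with c have "\<theta> s = \<phi> s + 2 * pi * of_int n" for s
    using c[of s] by (simp add: field_simps)
  then show thesis by (rule that)
qed

lemma circle_degree_eqI:
  assumes "continuous_on UNIV \<theta>" "\<And>s. f s = cis (\<theta> s)"
    and "\<And>s. \<theta> (s + l) = \<theta> s + 2 * pi * of_int d"
  shows "circle_degree l f = d"
  unfolding circle_degree_def
proof (rule the_equality)
  fix e :: int
  assume "\<exists>\<phi>. continuous_on UNIV \<phi> \<and> (\<forall>s. f s = cis (\<phi> s)) \<and>
              (\<forall>s. \<phi> (s + l) = \<phi> s + 2 * pi * of_int e)"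
  then obtain \<phi> where \<phi>: "continuous_on UNIV \<phi>" "\<And>s. f s = cis (\<phi> s)"
      "\<And>s. \<phi> (s + l) = \<phi> s + 2 * pi * of_int e"
    by blast
  obtain n :: int where n: "\<And>s. \<theta> s = \<phi> s + 2 * pi * of_int n"
    using cis_eq_imp_const_diff[of \<theta> \<phi>] assms \<phi> by metis
  from n[of l] n[of 0] \<phi>(3)[of 0] assms(3)[of 0] show "e = d"
    by simp
qed (use assms in blast)

lemma circle_degree_lift:
  assumes "continuous_on UNIV f" "\<And>s. norm (f s) = 1" "\<And>s. f (s + l) = f s"
  obtains \<theta> where "continuous_on UNIV \<theta>" "\<And>s. f s = cis (\<theta> s)"
    "\<And>s. \<theta> (s + l) = \<theta> s + 2 * pi * of_int (circle_degree l f)"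
proof -
  have "\<And>s. f s \<noteq> 0"
    using assms(2) by (metis norm_zero zero_neq_one)
  then obtain g where g: "continuous_on UNIV g" "\<And>s. f s = exp (g s)"
    using continuous_logarithm_on_contractible[of UNIV f] assms(1) convex_imp_contractible
    by (metis UNIV_I convex_UNIV)
  define \<theta> where "\<theta> = (\<lambda>s. Im (g s))"
  have cont: "continuous_on UNIV \<theta>"
    unfolding \<theta>_def by (intro continuous_intros g)
  have lift: "f s = cis (\<theta> s)" for s
    using g(2)[of s] assms(2)[of s] by (simp add: \<theta>_def exp_eq_polar norm_mult)
  obtain n :: int where n: "\<And>s. \<theta> (s + l) = \<theta> s + 2 * pi * of_int n"
  proof (rule cis_eq_imp_const_diff[of "\<lambda>s. \<theta> (s + l)" \<theta>])
    show "continuous_on UNIV (\<lambda>s. \<theta> (s + l))"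
      by (rule continuous_on_compose2[OF cont]) (auto intro!: continuous_intros)
  qed (use cont lift assms(3) in auto)
  with circle_degree_eqI[OF cont lift n] show thesis
    by (auto intro: that cont lift)
qed

definition rotation_index :: "real \<Rightarrow> (real \<Rightarrow> complex) \<Rightarrow> int" where
  "rotation_index l \<alpha> = circle_degree l (\<lambda>s. sgn (curve_tangent \<alpha> s))"

definition winding_index :: "real \<Rightarrow> (real \<Rightarrow> complex) \<Rightarrow> complex \<Rightarrow> int" where
  "winding_index l \<alpha> p = circle_degree l (\<lambda>s. sgn (\<alpha> s - p))"

text \<open>One representative in \<open>[0, l)\<close> for each parameter on the circle.\<close>

definition backward_normals :: "real \<Rightarrow> (real \<Rightarrow> complex) \<Rightarrow> complex \<Rightarrow> real set" where
  "backward_normals l \<alpha> p = {s \<in> {0..<l}. \<exists>\<rho><0. \<alpha> s + \<rho> *\<^sub>R curve_normal \<alpha> s = p}"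

end

theory Submission
  imports Defs
begin

text \<open>
  Let \<open>w\<close> be the winding index about \<open>p\<close>, \<open>r\<close> the rotation index and \<open>m\<close> the number of backward
  normals through \<open>p\<close>. Read the position of \<open>\<alpha>\<close> relative to \<open>p\<close> in the frame that rotates with the
  unit normal \<open>n\<close>, that is, consider the closed curve \<open>f = (\<alpha> - p) / n = (\<alpha> - p) * cnj n\<close>. Since the
  normal turns as often as the tangent, the degree of \<open>f\<close> about the origin is \<open>w - r\<close>. A backward
  normal through \<open>p\<close> is a parameter at which \<open>\<alpha> - p\<close> is a positive multiple of \<open>n\<close>, that is, at
  which \<open>f\<close> meets the positive real axis.

  The Frenet equations give \<open>f' = - \<i> (1 + k f)\<close>. Where \<open>f\<close> is a positive real, positivity of \<open>k\<close>
  makes \<open>Im f\<close> strictly decreasing, so \<open>f\<close> meets the positive real axis only by crossing it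
  clockwise. Each crossing therefore counts \<open>-1\<close> towards the degree, nothing cancels, and the
  degree of \<open>f\<close> is \<open>- m\<close> (\<open>circle_degree_clockwise_crossings\<close>). For the lifted angle of \<open>f\<close>, measured
  in full turns, this says that a continuous function that passes every integer only downwards
  takes each integer value at most once (\<open>downward_crossings_count\<close>).
\<close>

section \<open>Counting downward crossings\<close>

text \<open>
  The first return to the level \<open>c\<close> would have to come from below, against the direction of
  crossing; so a condition on crossings that is only local rules out a second visit to the level.
\<close>

lemma downward_crossing_stays_below:
  fixes g :: "real \<Rightarrow> real" and c :: real
  assumes cont: "continuous_on UNIV g"
    and down: "\<And>s. g s = c \<Longrightarrow> \<exists>e>0. \<forall>h. 0 < h \<and> h < e \<longrightarrow> g (s + h) < c \<and> c < g (s - h)"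
    and "g a \<le> c" "a < b"
  shows "g b < c"
proof (rule ccontr)
  assume "\<not> g b < c"
  then have b: "c \<le> g b" by simp
  obtain a' where a': "a' < b" "g a' < c"
  proof (cases "g a = c")
    case True
    then obtain e where e: "e > 0" "\<And>h. 0 < h \<Longrightarrow> h < e \<Longrightarrow> g (a + h) < c"
      using down by blast
    let ?h = "min e (b - a) / 2"
    have "0 < ?h" "?h < e" "?h < b - a"
      using e(1) \<open>a < b\<close> by (auto simp: min_def)
    with e(2)[of ?h] show thesis
      by (intro that[of "a + ?h"]) linarith+
  next
    case False
    with assms show thesis by (intro that[of a]) auto
  qed
  \<comment> \<open>The first return to the level \<open>c\<close> is \<open>Inf A\<close>.\<close>
  define A where "A = {a'..b} \<inter> g -` {c..}"
  have "closed A"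
    unfolding A_def
    by (intro continuous_closed_preimage continuous_on_subset[OF cont]) auto
  moreover have "b \<in> A"
    using a' b by (simp add: A_def)
  moreover have "bdd_below A"
    by (auto simp: A_def bdd_below_def)
  ultimately have m: "Inf A \<in> A"
    by (intro closed_contains_Inf) auto
  define m where "m = Inf A"
  have before: "g x < c" if "a' \<le> x" "x < m" for x
  proof (rule ccontr)
    assume "\<not> g x < c"
    then have "x \<in> A"
      using that m by (auto simp: A_def m_def)
    then have "m \<le> x"
      unfolding m_def using \<open>bdd_below A\<close> by (rule cInf_lower)
    with that show False by simp
  qed
  have m_in: "a' \<le> m" "c \<le> g m"
    using m by (auto simp: A_def m_def)
  with a' have "a' < m"
    by (cases "a' = m") auto
  obtain x where "a' \<le> x" "x \<le> m" "g x = c"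
    using IVT'[of g a' c m] a' m_in continuous_on_subset[OF cont] by auto
  with before[of x] have "g m = c"
    by (cases "x = m") auto
  then obtain e where e: "e > 0" "\<And>h. 0 < h \<Longrightarrow> h < e \<Longrightarrow> c < g (m - h)"
    using down by blast
  let ?h = "min e (m - a') / 2"
  have "0 < ?h" "?h < e" "?h < m - a'"
    using e(1) \<open>a' < m\<close> by (auto simp: min_def)
  with e(2)[of ?h] before[of "m - ?h"] show False
    by linarith
qed

text \<open>
  The integers taken on \<open>[0, l)\<close> are those strictly above \<open>g l\<close> and not above \<open>g 0\<close>: the intermediate
  value theorem reaches each of these \<open>- d\<close> levels, and \<open>downward_crossing_stays_below\<close> excludes
  all other levels as well as repetitions.
\<close>

lemma downward_crossings_count:
  fixes g :: "real \<Rightarrow> real" and d :: int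
  assumes "l > 0" and cont: "continuous_on UNIV g" and step: "g l = g 0 + of_int d"
    and down: "\<And>s. g s \<in> \<int> \<Longrightarrow> \<exists>e>0. \<forall>h. 0 < h \<and> h < e \<longrightarrow> g (s + h) < g s \<and> g s < g (s - h)"
  shows "finite {s \<in> {0..<l}. g s \<in> \<int>}" (is "finite ?S")
    and "int (card {s \<in> {0..<l}. g s \<in> \<int>}) = - d"
proof -
  have below: "g b < of_int n" if "g a \<le> of_int n" "a < b" for a b n
  proof (rule downward_crossing_stays_below[OF cont _ that])
    fix s assume "g s = of_int n"
    then show "\<exists>e>0. \<forall>h. 0 < h \<and> h < e \<longrightarrow> g (s + h) < of_int n \<and> of_int n < g (s - h)"
      using down[of s] by simp
  qed
  have "g l < of_int \<lceil>g 0\<rceil>"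
    using \<open>l > 0\<close> by (intro below[of 0]) auto
  then have "of_int d < (1::real)"
    using step by linarith
  then have "d \<le> 0" by linarith
  let ?N = "{\<lfloor>g l\<rfloor><..\<lfloor>g 0\<rfloor>}"
  have bij: "bij_betw (\<lambda>s. \<lfloor>g s\<rfloor>) ?S ?N"
  proof (rule bij_betw_imageI)
    show "inj_on (\<lambda>s. \<lfloor>g s\<rfloor>) ?S"
    proof (rule linorder_inj_onI')
      fix s t assume "s \<in> ?S" "t \<in> ?S" "s < t"
      then obtain n where "g s = of_int n" by (auto elim: Ints_cases)
      with below[of s n t] \<open>s < t\<close> have "g t < of_int \<lfloor>g s\<rfloor>" by simp
      then show "\<lfloor>g s\<rfloor> \<noteq> \<lfloor>g t\<rfloor>" by linarith
    qed
    show "(\<lambda>s. \<lfloor>g s\<rfloor>) ` ?S = ?N"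
    proof (intro equalityI subsetI)
      fix n assume "n \<in> (\<lambda>s. \<lfloor>g s\<rfloor>) ` ?S"
      then obtain s where s: "0 \<le> s" "s < l" "g s = of_int n"
        by (auto elim!: Ints_cases)
      have "g l < of_int n"
        using s by (intro below[of s]) auto
      moreover have "of_int n \<le> g 0"
        using below[of 0 n s] s by (cases "s = 0") force+
      ultimately show "n \<in> ?N"
        by (simp add: floor_less_iff le_floor_iff)
    next
      fix n assume "n \<in> ?N"
      then have n: "g l < of_int n" "of_int n \<le> g 0"
        by (auto simp: floor_less_iff le_floor_iff)
      then obtain s where s: "0 \<le> s" "s \<le> l" "g s = of_int n"
        using IVT2'[OF less_imp_le[OF n(1)] n(2) less_imp_le[OF \<open>l > 0\<close>]
            continuous_on_subset[OF cont subset_UNIV]] by blast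
      with n have "s \<noteq> l" by auto
      with s have "s \<in> ?S" "n = \<lfloor>g s\<rfloor>" by auto
      then show "n \<in> (\<lambda>s. \<lfloor>g s\<rfloor>) ` ?S" by blast
    qed
  qed
  show "finite ?S"
    using bij_betw_finite[OF bij] by simp
  have "int (card ?S) = int (card ?N)"
    using bij_betw_same_card[OF bij] by simp
  also have "\<dots> = - d"
    using \<open>d \<le> 0\<close> step by simp
  finally show "int (card ?S) = - d" .
qed

section \<open>Degrees of maps to the circle\<close>

text \<open>
  Near a parameter where \<open>f\<close> is a positive real, the angle of \<open>f\<close> lies within a quarter turn of a
  multiple of \<open>2 \<pi>\<close>, so \<open>Im f\<close> tells on which side of that multiple it lies. Hence the angle in full turns passes
  integers only downwards.
\<close>

lemma circle_degree_clockwise_crossings: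
  fixes f :: "real \<Rightarrow> complex"
  assumes "l > 0" and cont: "continuous_on UNIV f" and nz: "\<And>s. f s \<noteq> 0"
    and per: "\<And>s. f (s + l) = f s"
    and down: "\<And>s. sgn (f s) = 1 \<Longrightarrow> \<exists>D<0. ((\<lambda>s. Im (f s)) has_real_derivative D) (at s)"
  shows "finite {s \<in> {0..<l}. sgn (f s) = 1}"
    and "int (card {s \<in> {0..<l}. sgn (f s) = 1}) = - circle_degree l (\<lambda>s. sgn (f s))"
proof -
  obtain \<theta> where \<theta>: "continuous_on UNIV \<theta>" "\<And>s. sgn (f s) = cis (\<theta> s)"
    "\<And>s. \<theta> (s + l) = \<theta> s + 2 * pi * of_int (circle_degree l (\<lambda>s. sgn (f s)))"
  proof (rule circle_degree_lift[of "\<lambda>s. sgn (f s)" l])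
    show "continuous_on UNIV (\<lambda>s. sgn (f s))"
      using nz by (intro continuous_intros cont) auto
  qed (use nz per in \<open>auto simp: norm_sgn\<close>)
  define g where "g s = \<theta> s / (2 * pi)" for s
  have g_cont: "continuous_on UNIV g"
    unfolding g_def by (intro continuous_intros \<theta>) auto
  have g_step: "g l = g 0 + of_int (circle_degree l (\<lambda>s. sgn (f s)))"
    using \<theta>(3)[of 0] by (simp add: g_def field_simps)
  have g_Ints: "g s \<in> \<int> \<longleftrightarrow> sgn (f s) = 1" for s
  proof -
    have "g s \<in> \<int> \<longleftrightarrow> (\<exists>n::int. \<theta> s = of_int n * 2 * pi)"
      by (auto simp: g_def field_simps elim!: Ints_cases)
    also have "\<dots> \<longleftrightarrow> cos (\<theta> s) = 1"
      by (simp add: cos_one_2pi_int)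
    also have "\<dots> \<longleftrightarrow> cis (\<theta> s) = 1"
      by (auto simp: complex_eq_iff cos_one_sin_zero)
    finally show ?thesis by (simp add: \<theta>)
  qed
  have g_Im: "Im (f s) = norm (f s) * sin (2 * pi * (g s - of_int n))" for s and n :: int
  proof -
    have "f s = norm (f s) * cis (\<theta> s)"
      using nz[of s] by (simp add: \<theta>(2)[symmetric] sgn_div_norm scaleR_conv_of_real)
    then have "Im (f s) = Im (norm (f s) * cis (\<theta> s))"
      by (rule arg_cong)
    then have "Im (f s) = norm (f s) * sin (\<theta> s)"
      by simp
    also have "sin (\<theta> s) = sin (2 * pi * (g s - of_int n))"
      by (simp add: g_def right_diff_distrib sin_diff)
    finally show ?thesis .
  qed
  have g_down: "\<exists>e>0. \<forall>h. 0 < h \<and> h < e \<longrightarrow> g (s + h) < g s \<and> g s < g (s - h)"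
    if "g s \<in> \<int>" for s
  proof -
    from that obtain n :: int where n: "g s = of_int n" by (auto elim: Ints_cases)
    from that have "sgn (f s) = 1" by (simp add: g_Ints)
    with down obtain D where D: "D < 0" "((\<lambda>s. Im (f s)) has_real_derivative D) (at s)"
      by blast
    have "Im (f s) = 0"
      using g_Im[of s n] n by simp
    with has_real_derivative_neg_dec_right[OF D(2,1)] has_real_derivative_neg_dec_left[OF D(2,1)]
    obtain e1 e2 where e12: "e1 > 0" "\<And>h. 0 < h \<Longrightarrow> h < e1 \<Longrightarrow> Im (f (s + h)) < 0"
      "e2 > 0" "\<And>h. 0 < h \<Longrightarrow> h < e2 \<Longrightarrow> 0 < Im (f (s - h))"
      by auto
    obtain e3 where e3: "e3 > 0" "\<And>x. \<bar>x - s\<bar> < e3 \<Longrightarrow> \<bar>g x - g s\<bar> < 1/4"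
      using g_cont unfolding continuous_on_iff dist_real_def
      by (metis UNIV_I zero_less_divide_1_iff zero_less_numeral)
    \<comment> \<open>Within a quarter turn of \<open>n\<close>, the sign of the sine is that of the deviation from \<open>n\<close>.\<close>
    have pos: "0 \<le> sin (2 * pi * x)" if "0 \<le> x" "x < 1/4" for x :: real
      using that by (intro sin_ge_zero) auto
    have neg: "sin (2 * pi * x) \<le> 0" if "x \<le> 0" "-1/4 < x" for x :: real
      using pos[of "-x"] that by simp
    have right: "g (s + h) < g s" if "0 < h" "h < e1" "h < e3" for h
    proof (rule ccontr)
      assume "\<not> g (s + h) < g s"
      then have "0 \<le> sin (2 * pi * (g (s + h) - of_int n))"
        using e3(2)[of "s + h"] that n by (intro pos) auto
      with e12(2)[of h] that show False
        by (simp add: g_Im[of _ n] mult_less_0_iff)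
    qed
    have left: "g s < g (s - h)" if "0 < h" "h < e2" "h < e3" for h
    proof (rule ccontr)
      assume "\<not> g s < g (s - h)"
      then have "sin (2 * pi * (g (s - h) - of_int n)) \<le> 0"
        using e3(2)[of "s - h"] that n by (intro neg) auto
      with e12(4)[of h] that show False
        by (simp add: g_Im[of _ n] zero_less_mult_iff)
    qed
    show ?thesis
      using right left e12 e3(1) by (intro exI[of _ "min (min e1 e2) e3"]) auto
  qed
  show "finite {s \<in> {0..<l}. sgn (f s) = 1}"
    and "int (card {s \<in> {0..<l}. sgn (f s) = 1}) = - circle_degree l (\<lambda>s. sgn (f s))"
    using downward_crossings_count[OF \<open>l > 0\<close> g_cont g_step g_down] by (simp_all add: g_Ints)
qed

lemma norm_sgn_scaleR: "x = norm x *\<^sub>R sgn (x :: 'a :: real_normed_vector)"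
  by (cases "x = 0") (simp_all add: sgn_div_norm)

lemma circle_degree_mult_cnj:
  assumes "continuous_on UNIV f" "\<And>s. norm (f s) = 1" "\<And>s. f (s + l) = f s"
    and "continuous_on UNIV g" "\<And>s. norm (g s) = 1" "\<And>s. g (s + l) = g s"
  shows "circle_degree l (\<lambda>s. f s * cnj (g s)) = circle_degree l f - circle_degree l g"
proof -
  obtain \<theta> where \<theta>: "continuous_on UNIV \<theta>" "\<And>s. f s = cis (\<theta> s)"
    "\<And>s. \<theta> (s + l) = \<theta> s + 2 * pi * of_int (circle_degree l f)"
    by (rule circle_degree_lift[of f l, OF assms(1-3)]) (rule that)
  obtain \<phi> where \<phi>: "continuous_on UNIV \<phi>" "\<And>s. g s = cis (\<phi> s)"
    "\<And>s. \<phi> (s + l) = \<phi> s + 2 * pi * of_int (circle_degree l g)"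
    by (rule circle_degree_lift[of g l, OF assms(4-6)]) (rule that)
  show ?thesis
  proof (rule circle_degree_eqI[of "\<lambda>s. \<theta> s - \<phi> s"])
    show "continuous_on UNIV (\<lambda>s. \<theta> s - \<phi> s)"
      by (intro continuous_intros \<theta> \<phi>)
    show "f s * cnj (g s) = cis (\<theta> s - \<phi> s)" for s
      by (simp add: \<theta>(2) \<phi>(2) cis_cnj cis_mult)
  qed (simp add: \<theta>(3) \<phi>(3) algebra_simps)
qed

lemma circle_degree_rotate:
  assumes "continuous_on UNIV f" "\<And>s. norm (f s) = 1" "\<And>s. f (s + l) = f s"
  shows "circle_degree l (\<lambda>s. cis a * f s) = circle_degree l f"
proof -
  obtain \<theta> where \<theta>: "continuous_on UNIV \<theta>" "\<And>s. f s = cis (\<theta> s)"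
    "\<And>s. \<theta> (s + l) = \<theta> s + 2 * pi * of_int (circle_degree l f)"
    by (rule circle_degree_lift[of f l, OF assms(1-3)]) (rule that)
  show ?thesis
    by (rule circle_degree_eqI[of "\<lambda>s. a + \<theta> s"])
       (auto intro!: continuous_intros \<theta>(1) simp: \<theta>(2,3) cis_mult)
qed

section \<open>The winding index of a locally convex curve\<close>

theorem theorem4:
  fixes \<alpha> :: "real \<Rightarrow> complex" and k :: "real \<Rightarrow> real" and l :: real and p :: complex
  assumes "l > 0"
    and "\<And>s. \<alpha> (s + l) = \<alpha> s"
    and "smooth_curve \<alpha>"
    and "\<And>s. norm (curve_tangent \<alpha> s) = 1"
    and "is_curvature \<alpha> k"
    and "\<And>s. k s > 0"
    and "p \<notin> range \<alpha>"
    and "p \<notin> range (evolute \<alpha> k)"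
  shows "finite (backward_normals l \<alpha> p) \<and>
         winding_index l \<alpha> p = rotation_index l \<alpha> - int (card (backward_normals l \<alpha> p))"
proof -
  define t n where "t = curve_tangent \<alpha>" and "n = curve_normal \<alpha>"
  define f where "f s = (\<alpha> s - p) * cnj (n s)" for s
  have n_t: "n s = \<i> * t s" for s
    by (simp add: n_def t_def curve_normal_def)
  have norm_t: "norm (t s) = 1" and norm_n: "norm (n s) = 1" for s
    using assms(4) by (simp_all add: n_t norm_mult t_def)
  have n_cnj: "n s * cnj (n s) = 1" for s
    using complex_norm_square[of "n s"] by (simp add: norm_n)
  have "\<alpha> differentiable (at s)" for s
    using assms(3) unfolding smooth_curve_def by (metis funpow_0)
  then have \<alpha>': "(\<alpha> has_vector_derivative t s) (at s)" for s
    by (simp add: t_def curve_tangent_def vector_derivative_works)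
  have t': "(t has_vector_derivative k s *\<^sub>R n s) (at s)" for s
    using assms(5) by (simp add: is_curvature_def t_def n_def)
  have t_per: "t (s + l) = t s" for s
  proof (rule vector_derivative_unique_at)
    have "((\<lambda>u. u + l) has_vector_derivative 1) (at s)"
      by (auto intro!: derivative_eq_intros)
    from vector_diff_chain_at[OF this \<alpha>']
    have "((\<lambda>u. \<alpha> (u + l)) has_vector_derivative t (s + l)) (at s)"
      by (simp add: o_def)
    then show "(\<alpha> has_vector_derivative t (s + l)) (at s)"
      by (simp add: assms(2))
  qed (rule \<alpha>')
  have cont_\<alpha>: "continuous_on UNIV \<alpha>" and cont_t: "continuous_on UNIV t"
    using \<alpha>' t' by (auto intro!: continuous_at_imp_continuous_on has_vector_derivative_continuous)
  have cont_n: "continuous_on UNIV n"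
    unfolding n_t by (intro continuous_intros cont_t)
  have nz: "\<alpha> s \<noteq> p" for s
    using assms(7) by auto
  have n_nz: "n s \<noteq> 0" for s
    using norm_n[of s] by auto
  have cont_f: "continuous_on UNIV f"
    unfolding f_def by (intro continuous_intros cont_\<alpha> cont_n)
  have f_nz: "f s \<noteq> 0" for s
    by (simp add: f_def nz n_nz)
  have f_per: "f (s + l) = f s" for s
    by (simp add: f_def n_t t_per assms(2))
  have f_sgn: "sgn (f s) = sgn (\<alpha> s - p) * cnj (n s)" for s
    unfolding f_def sgn_mult by (simp add: sgn_div_norm norm_n)

  \<comment> \<open>\<open>n = \<i> t\<close> is the tangent turned by \<open>pi / 2\<close>, so it has the degree of the tangent.\<close>
  have "circle_degree l (\<lambda>s. sgn (f s)) = winding_index l \<alpha> p - circle_degree l n"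
    unfolding f_sgn winding_index_def
  proof (rule circle_degree_mult_cnj)
    show "continuous_on UNIV (\<lambda>s. sgn (\<alpha> s - p))"
      using nz by (intro continuous_intros cont_\<alpha>) simp
  qed (simp_all add: cont_n norm_n norm_sgn nz assms(2), simp add: n_t t_per)
  also have "circle_degree l n = rotation_index l \<alpha>"
    using circle_degree_rotate[OF cont_t norm_t t_per, of "pi / 2"]
    by (simp add: rotation_index_def sgn_div_norm norm_t n_t[abs_def] flip: t_def)
  finally have degree: "circle_degree l (\<lambda>s. sgn (f s)) = winding_index l \<alpha> p - rotation_index l \<alpha>" .

  \<comment> \<open>The parameter along a backward normal through \<open>p\<close> is \<open>\<rho> = - f s\<close>.\<close>
  have normals: "backward_normals l \<alpha> p = {s \<in> {0..<l}. sgn (f s) = 1}"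
  proof -
    have "(\<exists>\<rho><0. \<alpha> s + \<rho> *\<^sub>R n s = p) \<longleftrightarrow> sgn (f s) = 1" for s
    proof
      assume "\<exists>\<rho><0. \<alpha> s + \<rho> *\<^sub>R n s = p"
      then obtain \<rho> where "\<rho> < 0" "\<alpha> s - p = - \<rho> *\<^sub>R n s" by auto
      then have "f s = of_real (- \<rho>)"
        by (simp add: f_def scaleR_conv_of_real mult.assoc n_cnj)
      with \<open>\<rho> < 0\<close> show "sgn (f s) = 1"
        by (simp only: sgn_of_real) simp
    next
      assume "sgn (f s) = 1"
      have "sgn (\<alpha> s - p) = sgn (\<alpha> s - p) * (n s * cnj (n s))"
        by (simp only: n_cnj mult_1_right)
      also have "\<dots> = n s * sgn (f s)"
        by (simp only: f_sgn mult_ac)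
      finally have "sgn (\<alpha> s - p) = n s"
        using \<open>sgn (f s) = 1\<close> by simp
      then have "\<alpha> s - p = norm (\<alpha> s - p) *\<^sub>R n s"
        using norm_sgn_scaleR[of "\<alpha> s - p"] by simp
      then have "\<alpha> s + (- norm (\<alpha> s - p)) *\<^sub>R n s = p"
        by (simp add: algebra_simps)
      with nz[of s] show "\<exists>\<rho><0. \<alpha> s + \<rho> *\<^sub>R n s = p"
        by (intro exI[of _ "- norm (\<alpha> s - p)"]) simp
    qed
    then show ?thesis by (simp add: backward_normals_def n_def)
  qed

  have f': "(f has_vector_derivative - \<i> * (1 + k s * f s)) (at s)" for s
  proof -
    have "(n has_vector_derivative \<i> * (k s *\<^sub>R n s)) (at s)"
      unfolding n_t[abs_def] using has_vector_derivative_mult_right[OF t', of \<i> s]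
      by (simp add: n_t)
    also have "\<i> * (k s *\<^sub>R n s) = - (k s * t s)"
      by (simp add: n_t complex_eq_iff)
    finally have "((\<lambda>s. cnj (n s)) has_vector_derivative cnj (- (k s * t s))) (at s)"
      by (rule has_vector_derivative_cnj)
    moreover have "((\<lambda>s. \<alpha> s - p) has_vector_derivative t s) (at s)"
      using has_vector_derivative_diff[OF \<alpha>' has_vector_derivative_const] by simp
    ultimately have
      "(f has_vector_derivative (\<alpha> s - p) * cnj (- (k s * t s)) + t s * cnj (n s)) (at s)"
      unfolding f_def[abs_def] by (rule has_vector_derivative_mult[rotated])
    also have "t s * cnj (n s) = - \<i>"
      using complex_norm_square[of "t s"] by (simp add: n_t norm_t)
    also have "(\<alpha> s - p) * cnj (- (k s * t s)) + - \<i> = - \<i> * (1 + k s * f s)"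
      by (simp add: f_def n_t complex_eq_iff algebra_simps)
    finally show ?thesis .
  qed
  have f_down: "\<exists>D<0. ((\<lambda>s. Im (f s)) has_real_derivative D) (at s)" if "sgn (f s) = 1" for s
  proof (intro exI conjI)
    have "f s = of_real (norm (f s))"
      using norm_sgn_scaleR[of "f s"] that by (simp add: scaleR_conv_of_real)
    then have "0 \<le> Re (f s)" by (metis Re_complex_of_real norm_ge_zero)
    then show "- (1 + k s * Re (f s)) < 0"
      using assms(6)[of s] by (smt (verit) mult_nonneg_nonneg)
    show "((\<lambda>s. Im (f s)) has_real_derivative - (1 + k s * Re (f s))) (at s)"
      using bounded_linear.has_vector_derivative[OF bounded_linear_Im f'[of s]]
      by (simp add: has_real_derivative_iff_has_vector_derivative)
  qed
  show ?thesis
    using circle_degree_clockwise_crossings[OF \<open>l > 0\<close> cont_f f_nz f_per f_down]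
    by (simp add: normals degree)
qed

end
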